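(* Let $r,s\in\mathbb{C}^*$ be roots of unity with $r^2\neq s^2$, and let $\lambda=(\lambda_1,\lambda_2,\lambda_3,\lambda_4)\in(\mathbb{C}^* )^3\times\mathbb{C}$ satisfy $\lambda_4\neq\frac{s^2(r^2-s^2)}{1-rs^{-1}}\lambda_3$. Then $\mathcal{M}_1(\lambda)$ is a simple $\mathcal{B}$-module of dimension $\ell_1m_1$.
   Context: $\mathcal{B}$ is the $\mathbb{C}$-algebra generated by $X_1,X_2,X_3,\tilde W$ with defining relations $$\tilde WX_1=r^{-2}X_1\tilde W,\quad X_2X_1=s^{-2}X_1X_2,\quad X_3X_1=(rs)^{-2}X_1X_3,\quad X_3X_2=(rs)^{-1}X_2X_3,$$ $$\tilde WX_3=rsX_3\tilde W,\quad \tilde WX_2=X_2\tilde W+s^2(r^2-s^2)X_3X_1.$$ (It is a subalgebra of the two-parameter quantized algebra $U^+_{r,s}(B_2)$.) All modules are right modules; $\operatorname{ord}(z)$ is the multiplicative order of $z$. Put $m_1=\operatorname{ord}(rs^{-1})$, and $\ell_1=\operatorname{ord}(r^2s^2)$ if $\operatorname{ord}(s^2)\mid\operatorname{ord}(r^2s^2)\operatorname{ord}(rs^{-1})$, $\ell_1=2\operatorname{ord}(r^2s^2)$ otherwise. $\mathcal{M}_1(\lambda)$ is the vector space with basis $\{e(a,b): 0\le a\le\ell_1-1,\ 0\le b\le m_1-1\}$ and action ($\oplus$ is addition modulo $\ell_1$) $$e(a,b)X_1=s^{-2b}\lambda_1e(a\oplus1,b),\qquad e(a,b)X_2=\begin{cases}\lambda_2e(a,b+1),&b\neq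 m_1-1,\\ s^{2am_1}\lambda_2e(a,0),&b=m_1-1,\end{cases}$$ $$e(a,b)X_3=(rs)^{2a+b}\lambda_1^{-1}\lambda_3e(a\oplus(-1),b),$$ $$e(a,b)\tilde W=\begin{cases}\lambda_2^{-1}(rs)^{2a}\left(\lambda_4-s^2(r^2-s^2)\frac{1-(rs^{-1})^b}{1-rs^{-1}}\lambda_3\right)e(a,b-1),&b\neq0,\\ \lambda_2^{-1}\lambda_4r^{2a}s^{-2a(m_1-1)}e(a,m_1-1),&b=0.\end{cases}$$ *)

theory Defs
  imports Complex_Main "HOL-Library.Poly_Mapping" "HOL-Algebra.Module" "HOL-Algebra.QuotRing"
begin

section \<open>The algebra\<close>

datatype gen = X1 | X2 | X3 | Wt

text \<open>The free monoid on the generators, written additively because that is what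
  \<^theory>\<open>HOL-Library.Poly_Mapping\<close> needs to supply the convolution product on
  finitely supported functions.\<close>

datatype word = Word (letters: "gen list")

instantiation word :: monoid_add
begin

definition zero_word :: word
  where "0 = Word []"

definition plus_word :: "word \<Rightarrow> word \<Rightarrow> word"
  where "u + v = Word (letters u @ letters v)"

instance
  by standard (simp_all add: zero_word_def plus_word_def)

end

type_synonym free_alg = "word \<Rightarrow>\<^sub>0 complex"

definition gen :: "gen \<Rightarrow> free_alg"
  where "gen g = Poly_Mapping.single (Word [g]) 1"

definition const :: "complex \<Rightarrow> free_alg"
  where "const c = Poly_Mapping.single 0 c"

definition free_algebra :: "free_alg ring"
  where "free_algebra = \<lparr>carrier = UNIV, mult = (*), one = 1, zero = 0, add = (+)\<rparr>"

lemma ring_free_algebra: "ring free_algebra"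
  by (rule ringI, rule abelian_groupI, simp_all add: free_algebra_def monoid_def algebra_simps)
    (metis add.right_inverse)

definition relators :: "complex \<Rightarrow> complex \<Rightarrow> free_alg set"
  where "relators r s =
    { gen Wt * gen X1 - const (r powi (-2)) * (gen X1 * gen Wt),
      gen X2 * gen X1 - const (s powi (-2)) * (gen X1 * gen X2),
      gen X3 * gen X1 - const ((r * s) powi (-2)) * (gen X1 * gen X3),
      gen X3 * gen X2 - const (inverse (r * s)) * (gen X2 * gen X3),
      gen Wt * gen X3 - const (r * s) * (gen X3 * gen Wt),
      gen Wt * gen X2 - (gen X2 * gen Wt + const (s^2 * (r^2 - s^2)) * (gen X3 * gen X1)) }"

definition B_ideal :: "complex \<Rightarrow> complex \<Rightarrow> free_alg set"
  where "B_ideal r s = genideal free_algebra (relators r s)"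

definition B_algebra :: "complex \<Rightarrow> complex \<Rightarrow> free_alg set ring"
  where "B_algebra r s = free_algebra Quot B_ideal r s"

text \<open>The image in the quotient of an element of the free algebra; the complex scalars act
  through the images of the constants.\<close>

definition B_class :: "complex \<Rightarrow> complex \<Rightarrow> free_alg \<Rightarrow> free_alg set"
  where "B_class r s p = B_ideal r s +>\<^bsub>free_algebra\<^esub> p"

section \<open>Simple right modules\<close>

text \<open>In a right module, \<open>a \<odot> x\<close> stands for the right action \<open>x \<cdot> a\<close>: the record field keeps
  the ring element first, and only associativity shows the side.\<close>

locale right_module = R?: ring + M?: abelian_group M for M (structure) +
  assumes smult_closed:
      "\<lbrakk>a \<in> carrier R; x \<in> carrier M\<rbrakk> \<Longrightarrow> a \<odot>\<^bsub>M\<^esub> x \<in> carrier M"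
    and smult_l_distr:
      "\<lbrakk>a \<in> carrier R; b \<in> carrier R; x \<in> carrier M\<rbrakk> \<Longrightarrow>
        (a \<oplus> b) \<odot>\<^bsub>M\<^esub> x = a \<odot>\<^bsub>M\<^esub> x \<oplus>\<^bsub>M\<^esub> b \<odot>\<^bsub>M\<^esub> x"
    and smult_r_distr:
      "\<lbrakk>a \<in> carrier R; x \<in> carrier M; y \<in> carrier M\<rbrakk> \<Longrightarrow>
        a \<odot>\<^bsub>M\<^esub> (x \<oplus>\<^bsub>M\<^esub> y) = a \<odot>\<^bsub>M\<^esub> x \<oplus>\<^bsub>M\<^esub> a \<odot>\<^bsub>M\<^esub> y"
    and smult_assoc_right:
      "\<lbrakk>a \<in> carrier R; b \<in> carrier R; x \<in> carrier M\<rbrakk> \<Longrightarrow>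
        (a \<otimes> b) \<odot>\<^bsub>M\<^esub> x = b \<odot>\<^bsub>M\<^esub> (a \<odot>\<^bsub>M\<^esub> x)"
    and smult_one:
      "x \<in> carrier M \<Longrightarrow> \<one> \<odot>\<^bsub>M\<^esub> x = x"

text \<open>The library's \<^const>\<open>submodule\<close> (an additive subgroup closed under the action) does not
  depend on the side.\<close>

definition simple_right_module :: "('a, 'c) ring_scheme \<Rightarrow> ('a, 'b, 'd) module_scheme \<Rightarrow> bool"
  where "simple_right_module R M \<longleftrightarrow>
    right_module R M \<and> carrier M \<noteq> {\<zero>\<^bsub>M\<^esub>} \<and>
    (\<forall>N. submodule N R M \<longrightarrow> N = {\<zero>\<^bsub>M\<^esub>} \<or> N = carrier M)"

section \<open>The module\<close>

definition root_of_unity :: "complex \<Rightarrow> bool"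
  where "root_of_unity z \<longleftrightarrow> (\<exists>n>0. z ^ n = 1)"

text \<open>Only meaningful for roots of unity.\<close>

definition mult_ord :: "complex \<Rightarrow> nat"
  where "mult_ord z = (LEAST n. 0 < n \<and> z ^ n = 1)"

definition m1 :: "complex \<Rightarrow> complex \<Rightarrow> nat"
  where "m1 r s = mult_ord (r * inverse s)"

definition ell1 :: "complex \<Rightarrow> complex \<Rightarrow> nat"
  where "ell1 r s =
    (if mult_ord (s^2) dvd mult_ord (r^2 * s^2) * mult_ord (r * inverse s)
     then mult_ord (r^2 * s^2) else 2 * mult_ord (r^2 * s^2))"

definition scale :: "complex \<Rightarrow> ('k \<Rightarrow>\<^sub>0 complex) \<Rightarrow> ('k \<Rightarrow>\<^sub>0 complex)"
  where "scale c v = Poly_Mapping.map ((*) c) v"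

lemma lookup_scale: "Poly_Mapping.lookup (scale c v) k = c * Poly_Mapping.lookup v k"
  by (simp add: scale_def Poly_Mapping.map.rep_eq when_def)

interpretation scale: vector_space "scale :: complex \<Rightarrow> ('k \<Rightarrow>\<^sub>0 complex) \<Rightarrow> _"
  by standard (auto intro!: poly_mapping_eqI simp: lookup_scale lookup_add algebra_simps)

type_synonym vec = "(nat \<times> nat) \<Rightarrow>\<^sub>0 complex"

definition e :: "nat \<Rightarrow> nat \<Rightarrow> vec"
  where "e a b = Poly_Mapping.single (a, b) 1"

text \<open>The action of the generators on the basis vectors \<open>e a b\<close>, where \<open>a < ell1 r s\<close> and
  \<open>b < m1 r s\<close>.  As \<open>a\<close> is a natural number, \<open>a \<oplus> (-1)\<close> is written
  \<open>(a + ell1 r s - 1) mod ell1 r s\<close>.\<close>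

fun basis_act :: "complex \<Rightarrow> complex \<Rightarrow> complex \<Rightarrow> complex \<Rightarrow> complex \<Rightarrow> complex \<Rightarrow>
    gen \<Rightarrow> nat \<Rightarrow> nat \<Rightarrow> vec"
  where
    "basis_act r s l1 l2 l3 l4 X1 a b =
      scale (s powi (- 2 * int b) * l1) (e ((a + 1) mod ell1 r s) b)"
  | "basis_act r s l1 l2 l3 l4 X2 a b =
      (if b \<noteq> m1 r s - 1 then scale l2 (e a (b + 1))
       else scale (s ^ (2 * a * m1 r s) * l2) (e a 0))"
  | "basis_act r s l1 l2 l3 l4 X3 a b =
      scale ((r * s) ^ (2 * a + b) * inverse l1 * l3) (e ((a + ell1 r s - 1) mod ell1 r s) b)"
  | "basis_act r s l1 l2 l3 l4 Wt a b =
      (if b \<noteq> 0 then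
         scale (inverse l2 * (r * s) ^ (2 * a) *
             (l4 - s^2 * (r^2 - s^2) * ((1 - (r * inverse s) ^ b) / (1 - r * inverse s)) * l3))
           (e a (b - 1))
       else
         scale (inverse l2 * l4 * r ^ (2 * a) * s powi (- 2 * int a * (int (m1 r s) - 1)))
           (e a (m1 r s - 1)))"

text \<open>Linear extension to the generators, then to words (the leftmost letter acts first) and to
  the free algebra.\<close>

definition gen_act :: "complex \<Rightarrow> complex \<Rightarrow> complex \<Rightarrow> complex \<Rightarrow> complex \<Rightarrow> complex \<Rightarrow>
    gen \<Rightarrow> vec \<Rightarrow> vec"
  where "gen_act r s l1 l2 l3 l4 g v =
    (\<Sum>(a, b)\<in>Poly_Mapping.keys v.
      scale (Poly_Mapping.lookup v (a, b)) (basis_act r s l1 l2 l3 l4 g a b))"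

definition free_act :: "complex \<Rightarrow> complex \<Rightarrow> complex \<Rightarrow> complex \<Rightarrow> complex \<Rightarrow> complex \<Rightarrow>
    free_alg \<Rightarrow> vec \<Rightarrow> vec"
  where "free_act r s l1 l2 l3 l4 p v =
    (\<Sum>w\<in>Poly_Mapping.keys p.
      scale (Poly_Mapping.lookup p w) (fold (gen_act r s l1 l2 l3 l4) (letters w) v))"

text \<open>A coset acts through any of its representatives.  That the choice does not matter, i.e. that
  the defining relations hold, is not built in; it is part of being a right module on which the
  classes of the generators act by \<^const>\<open>basis_act\<close>.  The fields \<open>mult\<close> and \<open>one\<close> of the record
  play no role in a module.\<close>

definition M1 :: "complex \<Rightarrow> complex \<Rightarrow> complex \<Rightarrow> complex \<Rightarrow> complex \<Rightarrow> complex \<Rightarrow>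
    (free_alg set, vec) module"
  where "M1 r s l1 l2 l3 l4 =
    \<lparr>carrier = {v. Poly_Mapping.keys v \<subseteq> {..<ell1 r s} \<times> {..<m1 r s}},
     mult = undefined, one = undefined, zero = 0, add = (+),
     smult = (\<lambda>C v. the_elem ((\<lambda>p. free_act r s l1 l2 l3 l4 p v) ` C))\<rparr>"

end

theory Submission
  imports Defs
begin

text \<open>Linear extension turns the generators into operators on the span of the \<open>e a b\<close>, and the
  defining relations reduce to identities between the coefficients; they survive the wrap-around
  of both indices because \<open>r ^ m = s ^ m\<close> and \<open>(rs) ^ (2l) = s ^ (2ml) = 1\<close>.  Hence the relators, and
  the ideal they generate, annihilate the space.

  For simplicity, the monomials \<open>X1 X3\<close>, \<open>X2 Wt\<close> and \<open>X2 ^ m\<close> act diagonally and together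
  separate the basis vectors, so a nonzero vector of minimal support in a submodule is a multiple of
  some \<open>e a b\<close>; from there \<open>X1\<close> and \<open>X2\<close>, whose coefficients never vanish, reach every basis
  vector.\<close>

section \<open>Linear extension from a basis\<close>

interpretation scale_pair: vector_space_pair
  "scale :: complex \<Rightarrow> ('j \<Rightarrow>\<^sub>0 complex) \<Rightarrow> _" "scale :: complex \<Rightarrow> ('k \<Rightarrow>\<^sub>0 complex) \<Rightarrow> _"
  by standard

abbreviation scale_linear :: "(('j \<Rightarrow>\<^sub>0 complex) \<Rightarrow> ('k \<Rightarrow>\<^sub>0 complex)) \<Rightarrow> bool"
  where "scale_linear \<equiv> Vector_Spaces.linear scale scale"

lemma scale_linearI:
  assumes "\<And>u v. f (u + v) = f u + f v" and "\<And>c v. f (scale c v) = scale c (f v)"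
  shows "scale_linear f"
  by (simp add: assms Vector_Spaces.linear_iff scale.vector_space_axioms)

lemma scale_single [simp]: "scale c (Poly_Mapping.single k d) = Poly_Mapping.single k (c * d)"
  by (rule poly_mapping_eqI) (simp add: lookup_scale lookup_single when_def)

lemma sum_singles:
  assumes "finite K" and "Poly_Mapping.keys v \<subseteq> K"
  shows "(\<Sum>k\<in>K. Poly_Mapping.single k (Poly_Mapping.lookup v k)) = v"
proof (rule poly_mapping_eqI)
  fix k
  have "Poly_Mapping.lookup v k = 0" if "k \<notin> K"
    using assms(2) that by (auto simp: not_in_keys_iff_lookup_eq_zero[symmetric])
  then show "Poly_Mapping.lookup (\<Sum>k\<in>K. Poly_Mapping.single k (Poly_Mapping.lookup v k)) k
      = Poly_Mapping.lookup v k"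
    using assms(1) by (auto simp: lookup_sum lookup_single when_def)
qed

text \<open>Both maps are determined by their values on basis vectors. Asking for agreement only on
  the support of \<open>v\<close> lets identities valid for restricted indices suffice on the span
  of those basis vectors.\<close>

lemma scale_linear_eq:
  assumes f: "scale_linear f" and g: "scale_linear g"
    and eq: "\<And>k. k \<in> Poly_Mapping.keys v \<Longrightarrow>
      f (Poly_Mapping.single k 1) = g (Poly_Mapping.single k 1)"
  shows "f v = g v"
proof -
  define u where "u k = scale (Poly_Mapping.lookup v k) (Poly_Mapping.single k 1)" for k
  have v: "v = (\<Sum>k\<in>Poly_Mapping.keys v. u k)"
    by (simp add: sum_singles u_def)
  have "f (u k) = g (u k)" if "k \<in> Poly_Mapping.keys v" for k
    unfolding u_def scale_pair.linear_scale[OF f] scale_pair.linear_scale[OF g] eq[OF that] ..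
  then have "f (\<Sum>k\<in>Poly_Mapping.keys v. u k) = g (\<Sum>k\<in>Poly_Mapping.keys v. u k)"
    by (simp add: scale_pair.linear_sum[OF f] scale_pair.linear_sum[OF g])
  then show ?thesis using v by simp
qed

lemma poly_mapping_add_induct [case_names zero single add]:
  fixes p :: "'k \<Rightarrow>\<^sub>0 'a :: comm_monoid_add"
  assumes "P 0" and "\<And>k c. P (Poly_Mapping.single k c)" and "\<And>p q. P p \<Longrightarrow> P q \<Longrightarrow> P (p + q)"
  shows "P p"
proof (induction p rule: update_induct)
  case const
  then show ?case using assms(1) by simp
next
  case (update p k c)
  have "Poly_Mapping.update k c p = p + Poly_Mapping.single k c"
    using update(1) by (intro poly_mapping_eqI)
      (auto simp: lookup_update lookup_add lookup_single when_def in_keys_iff)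
  then show ?case using assms(2,3) update(3) by simp
qed

text \<open>The common shape of \<open>gen_act\<close> (basis of index pairs) and
  \<open>free_act\<close> (basis of words), so that linearity is proved once for both.\<close>

definition lin_ext :: "('j \<Rightarrow> ('k \<Rightarrow>\<^sub>0 complex)) \<Rightarrow> ('j \<Rightarrow>\<^sub>0 complex) \<Rightarrow> ('k \<Rightarrow>\<^sub>0 complex)"
  where "lin_ext f p =
    (\<Sum>k\<in>Poly_Mapping.keys p. scale (Poly_Mapping.lookup p k) (f k))"

text \<open>Enlarging the index set adds only zero terms; over the union of two supports the sums
  for two arguments can be added term by term.\<close>

lemma lin_ext_superset:
  assumes "finite K" and "Poly_Mapping.keys p \<subseteq> K"
  shows "lin_ext f p = (\<Sum>k\<in>K. scale (Poly_Mapping.lookup p k) (f k))"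
  unfolding lin_ext_def using assms
  by (intro sum.mono_neutral_left) (auto simp: in_keys_iff)

lemma scale_linear_lin_ext: "scale_linear (lin_ext f)"
proof (rule scale_linearI)
  fix p q :: "'a \<Rightarrow>\<^sub>0 complex" and c :: complex
  let ?K = "Poly_Mapping.keys p \<union> Poly_Mapping.keys q"
  have "lin_ext f (p + q) = (\<Sum>k\<in>?K. scale (Poly_Mapping.lookup (p + q) k) (f k))"
    by (rule lin_ext_superset) (auto dest: subsetD[OF keys_add])
  also have "\<dots> = lin_ext f p + lin_ext f q"
    by (simp add: lin_ext_superset[of ?K] lookup_add scale.scale_left_distrib sum.distrib)
  finally show "lin_ext f (p + q) = lin_ext f p + lin_ext f q" .
  have "Poly_Mapping.keys (scale c p) \<subseteq> Poly_Mapping.keys p"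
    by (auto simp: in_keys_iff lookup_scale)
  then show "lin_ext f (scale c p) = scale c (lin_ext f p)"
    by (simp add: lin_ext_superset[of "Poly_Mapping.keys p"] lookup_scale scale.scale_sum_right)
qed

lemma lin_ext_single [simp]: "lin_ext f (Poly_Mapping.single k c) = scale c (f k)"
  by (simp add: lin_ext_def)

section \<open>The action of the free algebra\<close>

text \<open>No hypotheses yet: a free algebra acts through arbitrary linear operators. The
  assumptions on the parameters enter in \<open>M1_params\<close>, for the relations and for
  simplicity.\<close>

locale M1_action =
  fixes r s l1 l2 l3 l4 :: complex
begin

abbreviation act :: "gen \<Rightarrow> vec \<Rightarrow> vec"
  where "act \<equiv> gen_act r s l1 l2 l3 l4"

abbreviation alg_act :: "free_alg \<Rightarrow> vec \<Rightarrow> vec"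
  where "alg_act \<equiv> free_act r s l1 l2 l3 l4"

lemma gen_act_eq_lin_ext: "act g = lin_ext (\<lambda>(a, b). basis_act r s l1 l2 l3 l4 g a b)"
  by (rule ext) (simp add: gen_act_def lin_ext_def split_def)

lemma scale_linear_gen_act: "scale_linear (act g)"
  unfolding gen_act_eq_lin_ext by (rule scale_linear_lin_ext)

lemma gen_act_e: "act g (e a b) = basis_act r s l1 l2 l3 l4 g a b"
  by (simp add: gen_act_eq_lin_ext e_def)

lemma scale_linear_fold_gen_act: "scale_linear (fold act w)"
proof (induction w)
  case Nil
  then show ?case by (simp add: scale_linearI)
next
  case (Cons g w)
  then show ?case
    using Vector_Spaces.linear_compose[OF scale_linear_gen_act[of g] Cons] by (simp add: comp_def)
qed

lemma free_act_eq_lin_ext: "alg_act p v = lin_ext (\<lambda>w. fold act (letters w) v) p"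
  by (simp add: free_act_def lin_ext_def)

lemma free_act_single: "alg_act (Poly_Mapping.single w c) v = scale c (fold act (letters w) v)"
  by (simp add: free_act_eq_lin_ext)

lemma free_act_add: "alg_act (p + q) v = alg_act p v + alg_act q v"
  by (simp add: free_act_eq_lin_ext scale_pair.linear_add[OF scale_linear_lin_ext])

lemma free_act_0: "alg_act 0 v = 0"
  by (simp add: free_act_eq_lin_ext scale_pair.linear_0[OF scale_linear_lin_ext])

lemma free_act_minus: "alg_act (- p) v = - alg_act p v"
  using free_act_add[of p "- p" v] by (simp add: free_act_0 minus_unique)

lemma free_act_diff: "alg_act (p - q) v = alg_act p v - alg_act q v"
  using free_act_add[of p "- q" v] by (simp add: free_act_minus)

lemma scale_linear_free_act: "scale_linear (alg_act p)"
proof -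
  have "scale_linear (\<lambda>v. scale (Poly_Mapping.lookup p w) (fold act (letters w) v))" for w
    by (rule scale_pair.linear_compose_scale_right[OF scale_linear_fold_gen_act])
  then show ?thesis
    unfolding free_act_def by (intro scale_pair.linear_compose_sum ballI)
qed

text \<open>Additivity in both factors reduces this to two monomials, where folding over a
  concatenation composes the folds, the left word first. This is the associativity of a right
  action.\<close>

lemma free_act_mult: "alg_act (p * q) v = alg_act q (alg_act p v)"
proof (induction p rule: poly_mapping_add_induct)
  case zero
  then show ?case by (simp add: free_act_0 scale_pair.linear_0[OF scale_linear_free_act])
next
  case (add p p')
  then show ?case
    by (simp add: distrib_right free_act_add scale_pair.linear_add[OF scale_linear_free_act])
next
  case (single u c)
  show ?case
  proof (induction q rule: poly_mapping_add_induct)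
    case zero
    then show ?case by (simp add: free_act_0)
  next
    case (add q q')
    then show ?case by (simp add: distrib_left free_act_add)
  next
    case (single w d)
    then show ?case
      by (simp add: mult_single free_act_single plus_word_def
          scale_pair.linear_scale[OF scale_linear_fold_gen_act] mult.commute)
  qed
qed

lemma free_act_gen: "alg_act (gen g) v = act g v"
  by (simp add: gen_def free_act_single)

lemma free_act_const: "alg_act (const c) v = scale c v"
  by (simp add: const_def free_act_single zero_word_def)

lemma free_act_one: "alg_act 1 v = v"
  using free_act_const[of 1 v] by (simp add: const_def single_one)

lemmas free_act_simps = free_act_add free_act_diff free_act_mult free_act_gen free_act_const

end

section \<open>Multiplicative orders\<close>

lemma mult_ord:
  assumes "root_of_unity z"
  shows mult_ord_pos: "0 < mult_ord z" and power_mult_ord: "z ^ mult_ord z = 1"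
proof -
  have "\<exists>n. 0 < n \<and> z ^ n = 1" using assms by (simp add: root_of_unity_def)
  from LeastI_ex[OF this] show "0 < mult_ord z" "z ^ mult_ord z = 1"
    by (simp_all add: mult_ord_def)
qed

text \<open>Any period will do, not just the exact order; this allows \<open>l\<close> as a common
  period of \<open>\<rho>\<close> and \<open>\<sigma>\<close>.\<close>

lemma power_mod_cycle:
  fixes z :: "'a :: monoid_mult"
  assumes "z ^ n = 1"
  shows "z ^ (a mod n) = z ^ a"
  by (metis assms div_mult_mod_eq mult.commute mult_1 power_add power_mult power_one)

lemma power_succ_mod:
  fixes z :: "'a :: comm_monoid_mult"
  assumes "z ^ n = 1"
  shows "z ^ ((a + 1) mod n) = z * z ^ a"
  using assms by (simp add: power_mod_cycle)

lemma power_pred_mod: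
  fixes z :: "'a :: field"
  assumes "z ^ n = 1" and "0 < n" and "z \<noteq> 0"
  shows "z ^ ((a + n - 1) mod n) = z ^ a / z"
proof -
  have "z * z ^ (a + n - 1) = z ^ a"
    using assms(1,2) by (metis Suc_pred' add_gr_0 mult.right_neutral power_Suc power_add)
  then show ?thesis using assms by (simp add: power_mod_cycle field_simps)
qed

lemma succ_pred_mod: "((a + n - 1) mod n + 1) mod n = a"
  and pred_succ_mod: "((a + 1) mod n + n - 1) mod n = a" if "a < (n :: nat)"
proof -
  show "((a + n - 1) mod n + 1) mod n = a"
    using that by (simp add: mod_Suc_eq)
  show "((a + 1) mod n + n - 1) mod n = a"
    using that by (cases "a + 1 = n") simp_all
qed

lemma power_eq_1_iff_mult_ord_dvd:
  assumes "root_of_unity z"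
  shows "z ^ n = 1 \<longleftrightarrow> mult_ord z dvd n"
proof
  assume "z ^ n = 1"
  then have "z ^ (n mod mult_ord z) = 1" by (simp add: power_mod_cycle power_mult_ord assms)
  moreover have "n mod mult_ord z < mult_ord z" by (simp add: mult_ord_pos assms)
  ultimately have "n mod mult_ord z = 0"
    using not_less_Least[of "n mod mult_ord z" "\<lambda>n. 0 < n \<and> z ^ n = 1"]
    by (simp add: mult_ord_def)
  then show "mult_ord z dvd n" by (simp add: dvd_eq_mod_eq_0)
next
  assume "mult_ord z dvd n"
  then obtain k where "n = mult_ord z * k" ..
  then show "z ^ n = 1" by (simp only: power_mult power_mult_ord[OF assms] power_one)
qed

lemma root_of_unity_mult:
  assumes "root_of_unity z" and "root_of_unity w"
  shows "root_of_unity (z * w)"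
proof -
  obtain i j where "0 < i" "z ^ i = 1" "0 < j" "w ^ j = 1"
    using assms by (auto simp: root_of_unity_def)
  then have "z ^ (i * j) = 1" "w ^ (j * i) = 1"
    by (simp_all add: power_mult)
  then have "(z * w) ^ (i * j) = 1"
    by (simp add: power_mult_distrib mult.commute)
  then show ?thesis
    unfolding root_of_unity_def using \<open>0 < i\<close> \<open>0 < j\<close> by (meson nat_0_less_mult_iff)
qed

lemma root_of_unity_inverse: "root_of_unity z \<Longrightarrow> root_of_unity (inverse z)"
  unfolding root_of_unity_def by (auto simp: power_inverse)

lemma root_of_unity_power: "root_of_unity z \<Longrightarrow> root_of_unity (z ^ k)"
  by (induction k) (auto simp: root_of_unity_mult, auto simp: root_of_unity_def)

section \<open>The action on the basis\<close>

locale M1_params = M1_action +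
  assumes r0: "r \<noteq> 0" and s0: "s \<noteq> 0"
    and r_root: "root_of_unity r" and s_root: "root_of_unity s" and r2_s2: "r^2 \<noteq> s^2"
    and l10: "l1 \<noteq> 0" and l20: "l2 \<noteq> 0" and l30: "l3 \<noteq> 0"
    and l4: "l4 \<noteq> s^2 * (r^2 - s^2) / (1 - r * inverse s) * l3"
begin

abbreviation l :: nat where "l \<equiv> ell1 r s"
abbreviation m :: nat where "m \<equiv> m1 r s"

text \<open>Raising \<open>a\<close> by one multiplies the coefficient of \<open>X3\<close> by
  \<open>\<rho>\<close> and the wrap-around coefficient of \<open>X2\<close> by
  \<open>\<sigma>\<close>; \<open>q\<close> has order \<open>m\<close> and governs the index
  \<open>b\<close>.\<close>

definition \<rho> :: complex where "\<rho> = (r * s)^2"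
definition \<sigma> :: complex where "\<sigma> = s ^ (2 * m)"
definition q :: complex where "q = r * inverse s"

text \<open>Up to the factor \<open>\<rho> ^ a\<close>, the eigenvalue on \<open>e a b\<close> of
  \<open>Wt\<close> followed by \<open>X2\<close>. Since \<open>\<gamma> 0 = l4\<close>, one formula
  covers both cases in the action of \<open>Wt\<close>.\<close>

definition \<gamma> :: "nat \<Rightarrow> complex"
  where "\<gamma> b = l4 - s^2 * (r^2 - s^2) * ((1 - q ^ b) / (1 - q)) * l3"

lemma nonzero [simp]: "r \<noteq> 0" "s \<noteq> 0" "l1 \<noteq> 0" "l2 \<noteq> 0" "l3 \<noteq> 0" "\<rho> \<noteq> 0" "\<sigma> \<noteq> 0" "q \<noteq> 0"
  by (simp_all add: r0 s0 l10 l20 l30 \<rho>_def \<sigma>_def q_def)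

lemma q_neq_1 [simp]: "q \<noteq> 1" "1 - q \<noteq> 0"
  using r2_s2 s0 by (auto simp: q_def field_simps)

lemma q_root: "root_of_unity q"
  by (simp add: q_def root_of_unity_mult root_of_unity_inverse r_root s_root)

lemma m_pos [simp]: "0 < m" and q_m: "q ^ m = 1"
  using mult_ord[OF q_root] by (simp_all add: m1_def q_def)

lemma \<rho>_eq: "\<rho> = r^2 * s^2"
  by (simp add: \<rho>_def power_mult_distrib)

lemma \<rho>_root: "root_of_unity \<rho>"
  by (simp add: \<rho>_def root_of_unity_mult root_of_unity_power r_root s_root)

lemma r_m: "r ^ m = s ^ m"
  using q_m by (simp add: q_def power_mult_distrib field_simps)

text \<open>From \<open>r ^ m = s ^ m\<close>. It shows that wrapping \<open>b\<close> around
  changes the factor \<open>(r * s) ^ b\<close> of \<open>X3\<close> by the same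
  \<open>\<sigma>\<close> that appears in \<open>X2\<close>.\<close>

lemma \<sigma>_eq: "\<sigma> = (r * s) ^ m"
  by (simp add: \<sigma>_def power_mult_distrib r_m mult_2 power_add)

lemma ell1_\<rho>: "l = (if mult_ord (s^2) dvd mult_ord \<rho> * m then mult_ord \<rho> else 2 * mult_ord \<rho>)"
  by (simp add: ell1_def m1_def \<rho>_eq)

lemma l_pos [simp]: "0 < l"
  by (simp add: ell1_\<rho> mult_ord_pos[OF \<rho>_root])

lemma \<rho>_l: "\<rho> ^ l = 1"
  by (simp add: power_eq_1_iff_mult_ord_dvd[OF \<rho>_root] ell1_\<rho>)

text \<open>The left-hand power is a power of \<open>s^2\<close>, so the case distinction in
  \<open>ell1\<close> asks exactly whether the order of \<open>\<rho>\<close> is already a period of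
  \<open>\<sigma>\<close>.\<close>

lemma \<sigma>_mult_ord_\<rho>: "\<sigma> ^ mult_ord \<rho> = 1 \<longleftrightarrow> mult_ord (s^2) dvd mult_ord \<rho> * m"
proof -
  have "\<sigma> ^ mult_ord \<rho> = (s^2) ^ (mult_ord \<rho> * m)"
    by (simp add: \<sigma>_def mult.commute mult.left_commute flip: power_mult)
  then show ?thesis
    by (simp add: power_eq_1_iff_mult_ord_dvd root_of_unity_power s_root)
qed

text \<open>Since \<open>\<sigma> ^ 2 = \<rho> ^ m\<close>, doubling the order of
  \<open>\<rho>\<close> always gives a period of \<open>\<sigma>\<close>.\<close>

lemma \<sigma>_2: "\<sigma> ^ (2 * mult_ord \<rho>) = 1"
proof -
  have "\<sigma> ^ (2 * mult_ord \<rho>) = (\<rho> ^ mult_ord \<rho>) ^ m"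
    by (simp add: \<sigma>_eq \<rho>_def mult.commute mult.left_commute flip: power_mult)
  then show ?thesis by (simp add: power_mult_ord[OF \<rho>_root])
qed

lemma \<sigma>_l: "\<sigma> ^ l = 1"
  using \<sigma>_mult_ord_\<rho> \<sigma>_2 by (simp add: ell1_\<rho>)

text \<open>With \<open>\<rho>_l\<close> and \<open>\<sigma>_l\<close> this makes \<open>l\<close>
  the least common period of \<open>\<rho>\<close> and \<open>\<sigma>\<close>. An odd multiple of
  the order of \<open>\<rho>\<close> is a period of \<open>\<sigma>\<close> only if that order
  itself is one.\<close>

lemma \<rho>_\<sigma>_eq_1_imp_l_dvd:
  assumes "\<rho> ^ d = 1" and "\<sigma> ^ d = 1"
  shows "l dvd d"
proof -
  obtain k where d: "d = mult_ord \<rho> * k"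
    using assms(1) power_eq_1_iff_mult_ord_dvd[OF \<rho>_root] by (auto simp: dvd_def)
  show ?thesis
  proof (cases "\<sigma> ^ mult_ord \<rho> = 1 \<or> even k")
    case True
    then show ?thesis using d \<sigma>_mult_ord_\<rho> by (auto simp: ell1_\<rho>)
  next
    case False
    then obtain j where "k = 2 * j + 1" by (auto elim: oddE)
    then have "\<sigma> ^ d = (\<sigma> ^ (2 * mult_ord \<rho>)) ^ j * \<sigma> ^ mult_ord \<rho>"
      by (simp add: d algebra_simps flip: power_mult power_add)
    then show ?thesis using False assms(2) \<sigma>_2 by simp
  qed
qed

lemmas power_simps =
  power_succ_mod[OF \<rho>_l] power_succ_mod[OF \<sigma>_l]
  power_pred_mod[OF \<rho>_l] power_pred_mod[OF \<sigma>_l]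

lemma \<gamma>_0: "\<gamma> 0 = l4"
  by (simp add: \<gamma>_def)

lemma \<gamma>_succ_mod: "\<gamma> ((b + 1) mod m) = \<gamma> (b + 1)"
  by (simp add: \<gamma>_def power_succ_mod[OF q_m, simplified])

text \<open>One step of the geometric sum; the increment is the source of the \<open>X3 X1\<close>
  term in the relation between \<open>Wt\<close> and \<open>X2\<close>.\<close>

lemma \<gamma>_diff: "\<gamma> b = \<gamma> (b + 1) + s^2 * (r^2 - s^2) * q ^ b * l3"
proof -
  have "(1 - q ^ (b + 1)) / (1 - q) = (1 - q ^ b) / (1 - q) + q ^ b"
    by (simp add: divide_simps) (simp add: algebra_simps)
  then show ?thesis by (simp add: \<gamma>_def algebra_simps)
qed

lemma \<rho>_power: "(r * s) ^ (2 * a) = \<rho> ^ a"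
  by (simp only: \<rho>_def power_mult)

lemma act_X1: "act X1 (e a b) = scale (l1 / s ^ (2 * b)) (e ((a + 1) mod l) b)"
proof -
  have "s powi (- 2 * int b) = inverse (s ^ (2 * b))"
    by (metis int_ops(7) mult_minus_left of_nat_numeral power_int_minus power_int_of_nat)
  then show ?thesis by (simp add: gen_act_e field_simps)
qed

text \<open>Both cases become one cyclic shift with a factor \<open>\<sigma> ^ a\<close> at the
  wrap-around, so that the relations turn into identities between coefficients.\<close>

lemma act_X2:
  assumes "b < m"
  shows "act X2 (e a b) =
    scale (l2 * (if b + 1 = m then \<sigma> ^ a else 1)) (e a ((b + 1) mod m))"
proof -
  have "s ^ (2 * a * m) = \<sigma> ^ a"
    by (simp add: \<sigma>_def mult.commute mult.left_commute flip: power_mult)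
  then show ?thesis using assms by (auto simp: gen_act_e mult.commute)
qed

lemma act_X3:
  "act X3 (e a b) = scale (\<rho> ^ a * (r * s) ^ b * l3 / l1) (e ((a + l - 1) mod l) b)"
  by (simp add: gen_act_e power_add flip: \<rho>_power) (simp add: field_simps)

text \<open>For \<open>b = 0\<close>, splitting \<open>\<sigma> ^ a = s ^ (2 * a * m)\<close> into
  exponents \<open>2 * a * (m - 1)\<close> and \<open>2 * a\<close> turns the given coefficient into
  \<open>\<rho> ^ a / \<sigma> ^ a\<close>.\<close>

lemma act_Wt:
  assumes "b < m"
  shows "act Wt (e a b) =
    scale (\<rho> ^ a * (if b = 0 then inverse (\<sigma> ^ a) else 1) * \<gamma> b / l2) (e a ((b + m - 1) mod m))"
proof (cases "b = 0")
  case True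
  have "s powi (- 2 * int a * (int m - 1)) = inverse (s ^ (2 * a * (m - 1)))"
  proof -
    have "- 2 * int a * (int m - 1) = - int (2 * a * (m - 1))"
      using m_pos by (simp add: of_nat_diff Suc_leI del: m_pos)
    then show ?thesis by (metis power_int_minus power_int_of_nat)
  qed
  moreover have "\<sigma> ^ a = s ^ (2 * a * (m - 1)) * (s ^ 2) ^ a"
  proof -
    have "2 * m * a = 2 * a * (m - 1) + 2 * a"
      using m_pos by (metis Suc_pred' add.commute mult.assoc mult.commute mult_Suc_right)
    then show ?thesis by (simp add: \<sigma>_def flip: power_mult power_add)
  qed
  moreover have "\<rho> ^ a = r ^ (2 * a) * (s ^ 2) ^ a"
    by (simp only: \<rho>_eq power_mult_distrib power_mult)
  ultimately have "r ^ (2 * a) * s powi (- 2 * int a * (int m - 1)) = \<rho> ^ a * inverse (\<sigma> ^ a)"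
    by (simp del: power_mult)
  then show ?thesis using True by (simp add: gen_act_e \<gamma>_0 field_simps)
next
  case False
  then have "(b + m - 1) mod m = b - 1" using assms by (cases b) simp_all
  then show ?thesis using False
    by (simp add: gen_act_e \<gamma>_def q_def flip: \<rho>_power) (simp add: field_simps)
qed

section \<open>The defining relations on basis vectors\<close>

lemmas act_scale = scale_pair.linear_scale[OF scale_linear_gen_act]

text \<open>At \<open>b = 0\<close> the wrapped index puts an extra \<open>\<sigma>\<close> into the
  denominator of the \<open>X1\<close> coefficient; it matches the step from
  \<open>\<sigma> ^ a\<close> to \<open>\<sigma> ^ (a + 1)\<close> in the denominator of
  \<open>Wt\<close>.\<close>

lemma rel_Wt_X1:
  assumes "a < l" and "b < m"
  shows "act X1 (act Wt (e a b)) = scale (r powi (-2)) (act Wt (act X1 (e a b)))"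
proof -
  have "s ^ (2 * ((b + m - 1) mod m)) * s^2 = (if b = 0 then \<sigma> else 1) * s ^ (2 * b)"
  proof (cases b)
    case 0
    obtain k where "m = Suc k" using gr0_implies_Suc[OF m_pos] by blast
    then show ?thesis using 0 unfolding \<sigma>_def by (simp flip: power_add)
  next
    case (Suc c)
    then show ?thesis using assms by (simp flip: power_add)
  qed
  then have s: "s ^ (2 * ((b + m - 1) mod m)) = (if b = 0 then \<sigma> else 1) * s ^ (2 * b) / s^2"
    by (simp add: field_simps)
  show ?thesis using assms
    by (simp add: act_X1 act_Wt act_scale s power_int_minus power_simps del: One_nat_def)
      (simp add: \<rho>_eq field_simps)
qed

lemma rel_X2_X1:
  assumes "a < l" and "b < m"
  shows "act X1 (act X2 (e a b)) = scale (s powi (-2)) (act X2 (act X1 (e a b)))"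
proof -
  have "s ^ (2 * ((b + 1) mod m)) * (if b + 1 = m then \<sigma> else 1) = s ^ (2 * b) * s^2"
  proof (cases "b + 1 = m")
    case True
    then have "m = Suc b" by simp
    then show ?thesis unfolding \<sigma>_def by (simp flip: power_add)
  next
    case False
    then show ?thesis using assms by (simp flip: power_add)
  qed
  then have s: "s ^ (2 * ((b + 1) mod m)) = s ^ (2 * b) * s^2 / (if b + 1 = m then \<sigma> else 1)"
    by (simp add: field_simps split: if_splits)
  show ?thesis using assms
    by (simp add: act_X1 act_X2 act_scale s power_int_minus power_simps del: One_nat_def)
      (simp add: field_simps)
qed

lemma rel_X3_X1:
  assumes "a < l" and "b < m"
  shows "act X1 (act X3 (e a b)) = scale ((r * s) powi (-2)) (act X3 (act X1 (e a b)))"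
  using assms
  by (simp add: act_X1 act_X3 act_scale power_int_minus power_simps succ_pred_mod pred_succ_mod
      del: One_nat_def flip: \<rho>_def)

text \<open>As \<open>(r * s) ^ m = \<sigma>\<close>, wrapping costs a factor
  \<open>\<sigma>\<close>. In \<open>rel_X3_X2\<close> it balances the drop from
  \<open>\<sigma> ^ a\<close> to \<open>\<sigma> ^ (a - 1)\<close> caused by
  \<open>X3\<close>.\<close>

lemma rs_succ_mod:
  assumes "b < m"
  shows "(r * s) ^ ((b + 1) mod m) = (r * s) ^ b * (r * s) / (if b + 1 = m then \<sigma> else 1)"
proof (cases "b + 1 = m")
  case True
  then have "m = Suc b" by simp
  then show ?thesis unfolding \<sigma>_eq by simp
next
  case False
  then show ?thesis using assms by simp
qed

lemma rs_pred_mod: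
  assumes "b < m"
  shows "(r * s) ^ ((b + m - 1) mod m) = (r * s) ^ b * (if b = 0 then \<sigma> else 1) / (r * s)"
proof (cases b)
  case 0
  obtain k where "m = Suc k" using gr0_implies_Suc[OF m_pos] by blast
  then show ?thesis using 0 unfolding \<sigma>_eq by simp
next
  case (Suc c)
  then show ?thesis using assms by simp
qed

lemma rel_X3_X2:
  assumes "a < l" and "b < m"
  shows "act X2 (act X3 (e a b)) = scale (inverse (r * s)) (act X3 (act X2 (e a b)))"
  using assms
  by (simp add: act_X2 act_X3 act_scale power_simps rs_succ_mod del: One_nat_def)
    (simp add: field_simps)

lemma rel_Wt_X3:
  assumes "a < l" and "b < m"
  shows "act X3 (act Wt (e a b)) = scale (r * s) (act Wt (act X3 (e a b)))"
  using assms
  by (simp add: act_Wt act_X3 act_scale power_simps rs_pred_mod del: One_nat_def)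
    (simp add: field_simps \<rho>_def power2_eq_square)

text \<open>The two shifts of \<open>a\<close> cancel, and
  \<open>(r * s) ^ b / s ^ (2 * b) = q ^ b\<close>.\<close>

lemma act_X1_X3:
  assumes "a < l" and "b < m"
  shows "act X3 (act X1 (e a b)) = scale (l3 * \<rho> * \<rho> ^ a * q ^ b) (e a b)"
proof -
  have "q ^ b * s ^ (2 * b) = (r * s) ^ b"
    by (simp add: q_def power_mult_distrib power_inverse mult_2 power_add)
  then show ?thesis using assms
    by (simp add: act_X1 act_X3 act_scale power_simps pred_succ_mod del: One_nat_def)
      (simp add: field_simps)
qed

lemma act_X3_X1:
  assumes "a < l" and "b < m"
  shows "act X1 (act X3 (e a b)) = scale (l3 * \<rho> ^ a * q ^ b) (e a b)"
  unfolding rel_X3_X1[OF assms] act_X1_X3[OF assms]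
  by (simp add: power_int_minus \<rho>_def)

text \<open>The factors \<open>l2\<close> and the wrap-around factors \<open>\<sigma> ^ a\<close> of
  the two operators cancel; \<open>\<gamma>\<close> has period \<open>m\<close> because
  \<open>q\<close> does.\<close>

lemma act_X2_Wt:
  assumes "a < l" and "b < m"
  shows "act Wt (act X2 (e a b)) = scale (\<rho> ^ a * \<gamma> (b + 1)) (e a b)"
  using assms
  by (auto simp: act_X2 act_Wt act_scale \<gamma>_succ_mod pred_succ_mod simp del: One_nat_def)

lemma act_Wt_X2:
  assumes "a < l" and "b < m"
  shows "act X2 (act Wt (e a b)) = scale (\<rho> ^ a * \<gamma> b) (e a b)"
proof -
  have "(b + m - 1) mod m + 1 = m \<longleftrightarrow> b = 0"
    using assms by (cases b) simp_all
  then show ?thesis using assms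
    by (simp add: act_X2 act_Wt act_scale succ_pred_mod del: One_nat_def)
qed

text \<open>All three products are diagonal, so the relation is \<open>\<gamma>_diff\<close>
  multiplied by \<open>\<rho> ^ a\<close>.\<close>

lemma rel_Wt_X2:
  assumes "a < l" and "b < m"
  shows "act X2 (act Wt (e a b)) = act Wt (act X2 (e a b))
    + scale (s^2 * (r^2 - s^2)) (act X1 (act X3 (e a b)))"
  unfolding act_Wt_X2[OF assms] act_X2_Wt[OF assms] act_X3_X1[OF assms] scale.scale_scale
    scale.scale_left_distrib[symmetric] \<gamma>_diff[of b]
  by (simp add: algebra_simps)

section \<open>The carrier as a stable subspace\<close>

abbreviation M :: "(free_alg set, vec) module" where "M \<equiv> M1 r s l1 l2 l3 l4"
abbreviation V :: "vec set" where "V \<equiv> carrier M"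

lemma M_zero [simp]: "\<zero>\<^bsub>M\<^esub> = 0" and M_add [simp]: "x \<oplus>\<^bsub>M\<^esub> y = x + y"
  by (simp_all add: M1_def)

lemma V_eq: "V = {v. Poly_Mapping.keys v \<subseteq> {..<l} \<times> {..<m}}"
  by (simp add: M1_def)

lemma keys_V:
  assumes "v \<in> V" and "k \<in> Poly_Mapping.keys v"
  obtains a b where "k = (a, b)" "a < l" "b < m"
  using assms by (cases k) (auto simp: V_eq)

lemma subspace_V: "scale.subspace V"
proof (rule scale.subspaceI)
  fix u v c assume *: "u \<in> V" "v \<in> V"
  then show "u + v \<in> V" using keys_add[of u v] by (auto simp: V_eq)
  have "Poly_Mapping.keys (scale c u) \<subseteq> Poly_Mapping.keys u"
    by (auto simp: in_keys_iff lookup_scale)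
  with * show "scale c u \<in> V" by (auto simp: V_eq)
qed (simp add: V_eq)

lemma e_in_V [simp]: "a < l \<Longrightarrow> b < m \<Longrightarrow> e a b \<in> V"
  by (simp add: V_eq e_def)

lemma expand_V:
  assumes "v \<in> V"
  shows "v = (\<Sum>(a, b)\<in>{..<l} \<times> {..<m}. scale (Poly_Mapping.lookup v (a, b)) (e a b))"
  using assms sum_singles[of "{..<l} \<times> {..<m}" v] by (simp add: V_eq e_def split_def)

lemma scale_linear_eq_V:
  assumes "scale_linear f" and "scale_linear g" and "v \<in> V"
    and "\<And>a b. a < l \<Longrightarrow> b < m \<Longrightarrow> f (e a b) = g (e a b)"
  shows "f v = g v"
  using assms(1,2) by (rule scale_linear_eq) (metis assms(3,4) e_def keys_V)

lemma scale_linear_in_V: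
  assumes "scale_linear f" and "v \<in> V" and "\<And>a b. a < l \<Longrightarrow> b < m \<Longrightarrow> f (e a b) \<in> V"
  shows "f v \<in> V"
proof -
  have "f v = (\<Sum>(a, b)\<in>{..<l} \<times> {..<m}. scale (Poly_Mapping.lookup v (a, b)) (f (e a b)))"
    by (subst expand_V[OF assms(2)])
      (simp add: split_def scale_pair.linear_sum[OF assms(1)] scale_pair.linear_scale[OF assms(1)])
  also have "\<dots> \<in> V"
    using assms(3) by (intro scale.subspace_sum[OF subspace_V])
      (auto intro: scale.subspace_scale[OF subspace_V])
  finally show ?thesis .
qed

lemma gen_act_in_V:
  assumes "v \<in> V"
  shows "act g v \<in> V"
proof (rule scale_linear_in_V[OF scale_linear_gen_act assms])
  fix a b assume "a < l" "b < m"
  then show "act g (e a b) \<in> V"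
    by (cases g) (simp_all add: act_X1 act_X2 act_X3 act_Wt scale.subspace_scale[OF subspace_V]
        del: One_nat_def)
qed

lemma fold_gen_act_in_V: "v \<in> V \<Longrightarrow> fold act w v \<in> V"
  by (induction w arbitrary: v) (simp_all add: gen_act_in_V)

lemma free_act_in_V: "v \<in> V \<Longrightarrow> alg_act p v \<in> V"
  unfolding free_act_def
  by (intro scale.subspace_sum scale.subspace_scale subspace_V fold_gen_act_in_V)

section \<open>Passing to the quotient\<close>

text \<open>The relations were checked only for \<open>a < l\<close> and \<open>b < m\<close>, hence
  the restriction to \<open>V\<close>.\<close>

lemma relators_act:
  assumes "p \<in> relators r s" and "v \<in> V"
  shows "alg_act p v = 0"
proof -
  have "alg_act p (e a b) = 0" if "a < l" "b < m" for a b
    using assms(1) unfolding relators_def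
    by (auto simp: free_act_simps rel_Wt_X1[OF that] rel_X2_X1[OF that] rel_X3_X1[OF that]
        rel_X3_X2[OF that] rel_Wt_X3[OF that] rel_Wt_X2[OF that] act_scale)
  moreover have "scale_linear (\<lambda>v. 0 :: vec)" by (rule scale_linearI) simp_all
  ultimately show ?thesis
    using scale_linear_eq_V[OF scale_linear_free_act _ assms(2), of "\<lambda>v. 0" p] by simp
qed

text \<open>A factor on the left acts first, so closure on that side rests on the stability of
  \<open>V\<close>; closure on the other side is linearity.\<close>

lemma annihilator_ideal: "ideal {p. \<forall>v\<in>V. alg_act p v = 0} free_algebra"
proof (rule idealI[OF ring_free_algebra])
  show "subgroup {p. \<forall>v\<in>V. alg_act p v = 0} (add_monoid free_algebra)"
  proof (rule group.subgroupI)
    show "group (add_monoid free_algebra)"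
      by (rule abelian_group.a_group[OF ring.is_abelian_group[OF ring_free_algebra]])
    fix p assume p: "p \<in> {p. \<forall>v\<in>V. alg_act p v = 0}"
    have "inv\<^bsub>add_monoid free_algebra\<^esub> p = - p"
      by (intro group.inv_equality[OF \<open>group (add_monoid free_algebra)\<close>])
        (simp_all add: free_algebra_def)
    then show "inv\<^bsub>add_monoid free_algebra\<^esub> p \<in> {p. \<forall>v\<in>V. alg_act p v = 0}"
      using p by (simp add: free_act_minus)
  qed (auto simp: free_algebra_def free_act_add intro!: exI[of _ 0] free_act_0)
next
  fix p q assume "p \<in> {p. \<forall>v\<in>V. alg_act p v = 0}"
  then show "q \<otimes>\<^bsub>free_algebra\<^esub> p \<in> {p. \<forall>v\<in>V. alg_act p v = 0}"
    and "p \<otimes>\<^bsub>free_algebra\<^esub> q \<in> {p. \<forall>v\<in>V. alg_act p v = 0}"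
    by (simp_all add: free_algebra_def free_act_mult free_act_in_V
        scale_pair.linear_0[OF scale_linear_free_act])
qed

lemma B_ideal_act: "p \<in> B_ideal r s \<Longrightarrow> v \<in> V \<Longrightarrow> alg_act p v = 0"
  using ring.genideal_minimal[OF ring_free_algebra annihilator_ideal, of "relators r s"]
    relators_act
  unfolding B_ideal_def by blast

lemma ideal_B_ideal: "ideal (B_ideal r s) free_algebra"
  unfolding B_ideal_def
  by (rule ring.genideal_ideal[OF ring_free_algebra]) (simp add: free_algebra_def)

text \<open>Representatives differ by elements acting as zero, so the image of the coset is a
  singleton and \<open>the_elem\<close> is meaningful.\<close>

lemma B_class_act:
  assumes "v \<in> V"
  shows "B_class r s p \<odot>\<^bsub>M\<^esub> v = alg_act p v"
proof -
  \<comment> \<open>Makes \<open>p\<close> itself a representative, so the image is not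
    empty.\<close>
  have "0 \<in> B_ideal r s"
    using additive_subgroup.zero_closed[OF ideal.axioms(1)[OF ideal_B_ideal]]
    by (simp add: free_algebra_def)
  then have "(\<lambda>x. alg_act x v) ` B_class r s p = {alg_act p v}"
    using B_ideal_act[OF _ assms]
    by (auto simp: B_class_def a_r_coset_def' free_algebra_def free_act_add image_iff)
  then show ?thesis by (simp add: M1_def)
qed

lemma carrier_B: "carrier (B_algebra r s) = range (B_class r s)"
  by (auto simp: B_algebra_def B_class_def FactRing_def A_RCOSETS_def' free_algebra_def)

lemma B_class_add: "B_class r s p \<oplus>\<^bsub>B_algebra r s\<^esub> B_class r s q' = B_class r s (p + q')"
  using ideal.a_rcos_sum[OF ideal_B_ideal, of p q']
  by (simp add: B_algebra_def B_class_def FactRing_def free_algebra_def)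

lemma B_class_mult: "B_class r s p \<otimes>\<^bsub>B_algebra r s\<^esub> B_class r s q' = B_class r s (p * q')"
  using ideal.rcoset_mult_add[OF ideal_B_ideal, of p q']
  by (simp add: B_algebra_def B_class_def FactRing_def free_algebra_def)

lemma B_class_one: "\<one>\<^bsub>B_algebra r s\<^esub> = B_class r s 1"
  by (simp add: B_algebra_def B_class_def FactRing_def free_algebra_def)

lemma abelian_group_M: "abelian_group M"
proof (rule abelian_groupI)
  fix x assume "x \<in> carrier M"
  then have "- x \<in> carrier M" by (rule scale.subspace_neg[OF subspace_V])
  then show "\<exists>y\<in>carrier M. y \<oplus>\<^bsub>M\<^esub> x = \<zero>\<^bsub>M\<^esub>"
    by (intro bexI[of _ "- x"]) simp_all
next
  fix x y assume "x \<in> carrier M" "y \<in> carrier M"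
  then show "x \<oplus>\<^bsub>M\<^esub> y \<in> carrier M" by (simp add: scale.subspace_add[OF subspace_V])
qed (simp_all add: scale.subspace_0[OF subspace_V] algebra_simps)

lemma right_module_M: "right_module (B_algebra r s) M"
proof (intro right_module.intro right_module_axioms.intro)
  show "ring (B_algebra r s)"
    unfolding B_algebra_def by (rule ideal.quotient_is_ring[OF ideal_B_ideal])
  show "abelian_group M" by (rule abelian_group_M)
qed (auto simp: carrier_B B_class_add B_class_mult B_class_one B_class_act free_act_in_V
    free_act_add free_act_mult free_act_one scale_pair.linear_add[OF scale_linear_free_act]
    scale.subspace_add[OF subspace_V])

section \<open>Simplicity\<close>

text \<open>\<open>D 0\<close> and \<open>D 1\<close> determine \<open>\<rho> ^ a\<close> and \<open>q ^ b\<close>, since the part of \<open>\<gamma> b\<close> independent of \<open>b\<close>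
  is nonzero by the hypothesis on \<open>l4\<close>; \<open>D 2\<close> distinguishes \<open>a\<close> from \<open>a + l div 2\<close> when \<open>l\<close> is
  twice the order of \<open>\<rho>\<close>.\<close>

definition D :: "nat \<Rightarrow> vec \<Rightarrow> vec"
  where "D i = (if i = 0 then act X3 \<circ> act X1 else if i = 1 then act Wt \<circ> act X2
    else act X2 ^^ m)"

definition \<mu> :: "nat \<Rightarrow> nat \<Rightarrow> nat \<Rightarrow> complex"
  where "\<mu> i a b = (if i = 0 then l3 * \<rho> * \<rho> ^ a * q ^ b else if i = 1 then \<rho> ^ a * \<gamma> (b + 1)
    else l2 ^ m * \<sigma> ^ a)"

text \<open>At most \<open>m\<close> steps from \<open>b < m\<close> wrap around at most once, hence
  at most one factor \<open>\<sigma> ^ a\<close>; for \<open>n = m\<close> there is exactly one,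
  whatever \<open>b\<close> is.\<close>

lemma act_X2_power:
  assumes "b < m" and "n \<le> m"
  shows "(act X2 ^^ n) (e a b) =
    scale (l2 ^ n * (if m \<le> b + n then \<sigma> ^ a else 1)) (e a ((b + n) mod m))"
  using assms(2)
proof (induction n)
  case 0
  then show ?case using assms(1) by simp
next
  case (Suc n)
  \<comment> \<open>A second wrap would need \<open>b + n + 1 = 2 * m\<close>, which the bounds
    exclude.\<close>
  have *: "(b + n) mod m + 1 = m \<longleftrightarrow> b + n + 1 = m"
  proof (cases "b + n < m")
    case False
    then have "(b + n) mod m = b + n - m"
      using assms(1) Suc.prems by (simp add: mod_if)
    then show ?thesis using False assms(1) Suc.prems by linarith
  qed simp
  have "(act X2 ^^ Suc n) (e a b) =
      scale (l2 ^ n * (if m \<le> b + n then \<sigma> ^ a else 1)) (act X2 (e a ((b + n) mod m)))"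
    using Suc by (simp add: act_scale)
  also have "act X2 (e a ((b + n) mod m)) =
      scale (l2 * (if b + n + 1 = m then \<sigma> ^ a else 1)) (e a ((b + Suc n) mod m))"
    using * by (simp add: act_X2 mod_Suc_eq)
  finally show ?case
    by (auto simp: ac_simps)
qed

lemma scale_linear_D: "scale_linear (D i)"
proof -
  have "scale_linear (act g ^^ n)" for g n
    by (induction n)
      (simp_all add: scale_linearI Vector_Spaces.linear_compose scale_linear_gen_act del: o_apply
        flip: id_def)
  moreover have "scale_linear (act g \<circ> act h)" for g h
    by (rule Vector_Spaces.linear_compose[OF scale_linear_gen_act scale_linear_gen_act])
  ultimately show ?thesis by (simp add: D_def)
qed

lemma D_e:
  assumes "a < l" and "b < m"
  shows "D i (e a b) = scale (\<mu> i a b) (e a b)"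
  using assms act_X2_power[OF assms(2) order_refl, of a]
  by (simp add: D_def \<mu>_def act_X1_X3 act_X2_Wt)

lemma lookup_D:
  assumes "v \<in> V" and "a < l" and "b < m"
  shows "Poly_Mapping.lookup (D i v) (a, b) = \<mu> i a b * Poly_Mapping.lookup v (a, b)"
proof -
  let ?K = "{..<l} \<times> {..<m}"
  have "D i v = (\<Sum>(a, b)\<in>?K. scale (Poly_Mapping.lookup v (a, b)) (D i (e a b)))"
    by (subst expand_V[OF assms(1)])
      (simp add: split_def scale_pair.linear_sum[OF scale_linear_D]
        scale_pair.linear_scale[OF scale_linear_D])
  also have "\<dots> = (\<Sum>k\<in>?K. Poly_Mapping.single k
      (Poly_Mapping.lookup v k * \<mu> i (fst k) (snd k)))"
    by (rule sum.cong) (auto simp: D_e, simp add: e_def)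
  finally show ?thesis using assms(2,3)
    by (simp add: lookup_sum lookup_single when_def)
qed

lemma power_q_inj:
  assumes "q ^ b = q ^ b'" and "b < m" and "b' < m"
  shows "b = b'"
proof -
  have "b = b'" if "q ^ b = q ^ b'" "b \<le> b'" "b' < m" for b b'
  proof -
    have "q ^ (b' - b) = 1" using that by (simp add: power_diff)
    then have "m dvd b' - b"
      using power_eq_1_iff_mult_ord_dvd[OF q_root] by (simp add: m1_def q_def)
    then show ?thesis using that by (auto dest: dvd_imp_le)
  qed
  then show ?thesis using assms by (metis nat_le_linear)
qed

lemma power_\<rho>_\<sigma>_inj:
  assumes "\<rho> ^ a = \<rho> ^ a'" and "\<sigma> ^ a = \<sigma> ^ a'" and "a < l" and "a' < l"
  shows "a = a'"
proof -
  have "a = a'" if "\<rho> ^ a = \<rho> ^ a'" "\<sigma> ^ a = \<sigma> ^ a'" "a \<le> a'" "a' < l" for a a'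
  proof -
    have "l dvd a' - a"
      using that by (intro \<rho>_\<sigma>_eq_1_imp_l_dvd) (simp_all add: power_diff)
    then show ?thesis using that by (auto dest: dvd_imp_le)
  qed
  then show ?thesis using assms by (metis nat_le_linear)
qed

lemma \<mu>_separates:
  assumes "a < l" "b < m" "a' < l" "b' < m" and eq: "\<And>i. \<mu> i a b = \<mu> i a' b'"
  shows "a = a' \<and> b = b'"
proof -
  define \<kappa> where "\<kappa> = s^2 * (r^2 - s^2) / (1 - q) * l3"
  have \<gamma>: "\<gamma> (b + 1) = l4 - \<kappa> + \<kappa> * q * q ^ b" for b
    unfolding \<gamma>_def \<kappa>_def by (simp add: diff_divide_distrib algebra_simps)
  have \<kappa>: "l4 - \<kappa> \<noteq> 0" using l4 by (simp add: \<kappa>_def q_def)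
  have 1: "\<rho> ^ a * q ^ b = \<rho> ^ a' * q ^ b'" using eq[of 0] by (simp add: \<mu>_def)
  have "\<rho> ^ a * \<gamma> (b + 1) = \<rho> ^ a' * \<gamma> (b' + 1)" using eq[of 1] by (simp add: \<mu>_def)
  \<comment> \<open>The part of the second eigenvalue that depends on \<open>b\<close> is a fixed
    multiple of \<open>\<rho> ^ a * q ^ b\<close>, known from the first; removing it isolates
    \<open>\<rho> ^ a\<close>.\<close>
  then have "\<rho> ^ a * (l4 - \<kappa>) + \<kappa> * q * (\<rho> ^ a * q ^ b)
      = \<rho> ^ a' * (l4 - \<kappa>) + \<kappa> * q * (\<rho> ^ a' * q ^ b')"
    unfolding \<gamma> by (simp only: algebra_simps)
  then have 2: "\<rho> ^ a = \<rho> ^ a'" unfolding 1 using \<kappa> by simp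
  have 3: "\<sigma> ^ a = \<sigma> ^ a'" using eq[of 2] by (simp add: \<mu>_def)
  show ?thesis
    using power_\<rho>_\<sigma>_inj[OF 2 3] power_q_inj[of b b'] 1 2 assms(1-4) by simp
qed

lemma submodule_eq_V:
  assumes "submodule N (B_algebra r s) M" and "N \<noteq> {0}"
  shows "N = V"
proof -
  have NV: "N \<subseteq> V"
    using subgroup.subset[OF submodule.axioms(1)[OF assms(1)]] by simp
  have N0: "0 \<in> N"
    using subgroup.one_closed[OF submodule.axioms(1)[OF assms(1)]] by simp
  have Nadd: "x + y \<in> N" if "x \<in> N" "y \<in> N" for x y
    using subgroup.m_closed[OF submodule.axioms(1)[OF assms(1)] that] by simp
  have Nalg: "alg_act p x \<in> N" if "x \<in> N" for p x
    using submodule.smult_closed[OF assms(1), of "B_class r s p" x] that NV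
    by (auto simp: carrier_B B_class_act)
  \<comment> \<open>A submodule is only an additive subgroup closed under the ring; the constants in
    the algebra make it a linear subspace.\<close>
  have Nscale: "scale c x \<in> N" if "x \<in> N" for c x
    using Nalg[OF that, of "const c"] by (simp add: free_act_const)
  have Nact: "act g x \<in> N" if "x \<in> N" for g x
    using Nalg[OF that, of "gen g"] by (simp add: free_act_gen)
  have Npow: "(act g ^^ n) x \<in> N" if "x \<in> N" for g n x
    using that by (induction n) (simp_all add: Nact)
  have ND: "D i x \<in> N" if "x \<in> N" for i x
    using that by (simp add: D_def Nact Npow)
  have sub: "scale.subspace N"
    by (rule scale.subspaceI) (simp_all add: N0 Nadd Nscale)
  have "\<exists>v. v \<in> N \<and> v \<noteq> 0" using assms(2) N0 by blast
  then obtain v where v: "v \<in> N" "v \<noteq> 0"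
    and min: "\<And>u. u \<in> N \<Longrightarrow> u \<noteq> 0 \<Longrightarrow>
      card (Poly_Mapping.keys v) \<le> card (Poly_Mapping.keys u)"
    using exE_some[OF ex_has_least_nat[of "\<lambda>v. v \<in> N \<and> v \<noteq> 0" _ "\<lambda>v. card (Poly_Mapping.keys v)"]]
    by blast
  obtain k where k: "k \<in> Poly_Mapping.keys v" using v(2) by (auto simp flip: keys_eq_empty)
  obtain a b where ab: "k = (a, b)" "a < l" "b < m" using keys_V[OF _ k] v(1) NV by blast
  have single: "k' = k" if k': "k' \<in> Poly_Mapping.keys v" for k'
  proof (rule ccontr)
    assume "k' \<noteq> k"
    obtain a' b' where ab': "k' = (a', b')" "a' < l" "b' < m"
      using keys_V[OF _ k'] v(1) NV by blast
    obtain i where i: "\<mu> i a b \<noteq> \<mu> i a' b'"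
      using \<mu>_separates ab ab' \<open>k' \<noteq> k\<close> by blast
    \<comment> \<open>Subtracting the eigenvalue at \<open>k\<close> kills that coordinate but not
      the one at \<open>k'\<close>, so \<open>u\<close> is nonzero with smaller support than
      \<open>v\<close>.\<close>
    define u where "u = D i v - scale (\<mu> i a b) v"
    have "u \<in> N"
      unfolding u_def using v(1) by (intro scale.subspace_diff[OF sub] ND Nscale)
    have lookup_u: "Poly_Mapping.lookup u (x, y) = (\<mu> i x y - \<mu> i a b) * Poly_Mapping.lookup v (x, y)"
      if "x < l" "y < m" for x y
      using lookup_D[of v x y i] v(1) NV that
      by (auto simp: u_def lookup_minus lookup_scale algebra_simps)
    have "Poly_Mapping.keys u \<subseteq> Poly_Mapping.keys v - {k}"
    proof
      fix j assume j: "j \<in> Poly_Mapping.keys u"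
      then obtain x y where "j = (x, y)" "x < l" "y < m"
        using keys_V[OF _ j] \<open>u \<in> N\<close> NV by blast
      then show "j \<in> Poly_Mapping.keys v - {k}"
        using j lookup_u[of x y] by (auto simp: in_keys_iff ab)
    qed
    then have "card (Poly_Mapping.keys u) < card (Poly_Mapping.keys v)"
      using k by (intro psubset_card_mono) auto
    moreover have "u \<noteq> 0"
      using lookup_u[of a' b'] ab' k' i by (auto simp: in_keys_iff)
    ultimately show False using min[OF \<open>u \<in> N\<close>] by simp
  qed
  have "Poly_Mapping.keys v \<subseteq> {k}" using single by blast
  then have "v = Poly_Mapping.single k (Poly_Mapping.lookup v k)"
    using sum_singles[of "{k}" v] by simp
  then have "scale (inverse (Poly_Mapping.lookup v k)) v = e a b"
    using k by (metis ab(1) e_def in_keys_iff left_inverse scale_single)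
  then have e_ab: "e a b \<in> N" using Nscale[OF v(1)] by metis
  have Ne: "e a b \<in> N" if "scale c (e a b) \<in> N" "c \<noteq> 0" for a b c
    using Nscale[OF that(1), of "inverse c"] that(2) by simp
  \<comment> \<open>Each application shifts the index cyclically, and its nonzero coefficient is
    divided out by \<open>Ne\<close>.\<close>
  have X1: "e ((a + n) mod l) b \<in> N" if "e a b \<in> N" "a < l" for a b n
  proof (induction n)
    case (Suc n)
    then have "act X1 (e ((a + n) mod l) b) \<in> N" by (rule Nact)
    then show ?case
      unfolding act_X1 by (auto dest!: Ne simp: mod_Suc_eq)
  qed (use that in simp)
  have X2: "e a ((b + n) mod m) \<in> N" if "e a b \<in> N" "b < m" for a b n
  proof (induction n)
    case (Suc n)
    then have "act X2 (e a ((b + n) mod m)) \<in> N" by (rule Nact)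
    then show ?case
      by (auto dest!: Ne simp: act_X2 mod_Suc_eq split: if_splits)
  qed (use that in simp)
  have "e a' b' \<in> N" if "a' < l" "b' < m" for a' b'
  proof -
    \<comment> \<open>Adding \<open>l\<close> keeps the number of steps from \<open>a\<close> to
      \<open>a'\<close> a natural number; it vanishes modulo \<open>l\<close>.\<close>
    have "e a' b \<in> N" using X1[OF e_ab ab(2), of "a' + l - a"] ab(2) that by simp
    then show ?thesis using X2[of a' b "b' + m - b"] ab(3) that by simp
  qed
  then have "v \<in> N" if "v \<in> V" for v
    by (subst expand_V[OF that]) (auto intro!: scale.subspace_sum[OF sub] Nscale)
  then show ?thesis using NV by blast
qed

lemma simple_M: "simple_right_module (B_algebra r s) M"
proof -
  have "e 0 0 \<in> V" by simp
  moreover have "e 0 0 \<noteq> 0" unfolding e_def by (metis keys_single keys_zero insert_not_empty zero_neq_one)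
  ultimately have "V \<noteq> {0}" by blast
  then show ?thesis
    unfolding simple_right_module_def using right_module_M submodule_eq_V by auto
qed

section \<open>The dimension\<close>

lemma dim_V: "scale.dim V = l * m"
proof -
  let ?K = "{..<l} \<times> {..<m}"
  let ?E = "(\<lambda>k. Poly_Mapping.single k 1 :: vec) ` ?K"
  have inj: "inj (\<lambda>k. Poly_Mapping.single k 1 :: vec)"
    by (rule injI) (metis keys_single singleton_inject zero_neq_one)
  have "scale.independent ?E"
  proof (rule scale.independent_if_scalars_zero)
    fix c x assume *: "(\<Sum>x\<in>?E. scale (c x) x) = 0" "x \<in> ?E"
    then obtain k where k: "k \<in> ?K" "x = Poly_Mapping.single k 1" by blast
    have "(\<Sum>k\<in>?K. Poly_Mapping.single k (c (Poly_Mapping.single k 1))) = 0"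
      using *(1) by (simp add: sum.reindex[OF inj_on_subset[OF inj]])
    \<comment> \<open>Evaluating the relation at \<open>k\<close> leaves only the coefficient of
      \<open>x\<close>.\<close>
    then have "(\<Sum>j\<in>?K. Poly_Mapping.lookup
        (Poly_Mapping.single j (c (Poly_Mapping.single j 1))) k) = 0"
      by (metis (mono_tags) lookup_sum lookup_zero)
    then show "c x = 0" using k by (simp add: lookup_single when_def)
  qed simp
  moreover have "scale.span ?E = V"
  proof
    show "scale.span ?E \<subseteq> V"
      using e_in_V by (intro scale.span_minimal subspace_V) (auto simp: e_def)
    show "V \<subseteq> scale.span ?E"
    proof
      fix v assume v: "v \<in> V"
      have "e a b \<in> scale.span ?E" if "a < l" "b < m" for a b
        unfolding e_def using that by (intro scale.span_base) auto
      then show "v \<in> scale.span ?E"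
        by (subst expand_V[OF v]) (auto intro!: scale.span_sum intro: scale.span_scale)
    qed
  qed
  moreover have "card ?E = l * m"
    by (simp add: card_image[OF inj_on_subset[OF inj]])
  ultimately show ?thesis using scale.dim_span_eq_card_independent by metis
qed

end

text \<open>Scalar multiplication in \<open>M1\<close> is defined through \<open>the_elem\<close>,
  so simplicity alone would not show that scalars and generators act as prescribed; the middle
  conjuncts record this.\<close>

theorem theorem5p1:
  fixes r s l1 l2 l3 l4 :: complex
  assumes "r \<noteq> 0" and "s \<noteq> 0"
    and "root_of_unity r" and "root_of_unity s"
    and "r^2 \<noteq> s^2"
    and "l1 \<noteq> 0" and "l2 \<noteq> 0" and "l3 \<noteq> 0"
    and "l4 \<noteq> s^2 * (r^2 - s^2) / (1 - r * inverse s) * l3"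
  shows "simple_right_module (B_algebra r s) (M1 r s l1 l2 l3 l4)
    \<and> (\<forall>c. \<forall>v \<in> carrier (M1 r s l1 l2 l3 l4).
          B_class r s (const c) \<odot>\<^bsub>M1 r s l1 l2 l3 l4\<^esub> v = scale c v)
    \<and> (\<forall>g. \<forall>a < ell1 r s. \<forall>b < m1 r s.
          B_class r s (gen g) \<odot>\<^bsub>M1 r s l1 l2 l3 l4\<^esub> e a b = basis_act r s l1 l2 l3 l4 g a b)
    \<and> vector_space.dim scale (carrier (M1 r s l1 l2 l3 l4)) = ell1 r s * m1 r s"
proof -
  interpret M1_params r s l1 l2 l3 l4
    using assms by unfold_locales
  show ?thesis
    using simple_M dim_V by (auto simp: B_class_act free_act_const free_act_gen gen_act_e)
qed

end
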